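(* Let $(V,\lhd,\rhd,\circ)$ be a pre-Gel'fand-Dorfman algebra over $\mathbb{C}$, write $a\ast b=a\rhd b+a\lhd b$ and $a\star b=a\rhd b+b\lhd a$, and let $R=\mathbb{C}[\partial]V$ be the corresponding quadratic left-symmetric conformal algebra. Let $\beta\in\mathbb{C}$ and let $\widehat{R}=R\oplus\mathbb{C}\mathfrak{c}_\beta$ be a central extension of $R$ by $\mathbb{C}\mathfrak{c}_\beta$ (where $\partial\mathfrak{c}_\beta=\beta\mathfrak{c}_\beta$) with $\lambda$-products $$\widehat{a_\lambda b}=\partial(b\lhd a)+a\circ b+\lambda(a\star b)+\alpha_\lambda(a,b)\mathfrak{c}_\beta,\qquad a,b\in V.$$ Suppose $\alpha_\lambda(a,b)=\sum_{i=0}^n\lambda^i\alpha_i(a,b)\in\mathbb{C}[\lambda]$ for all $a,b\in V$, with $\alpha_i(\cdot,\cdot):V\times V\to\mathbb{C}$ and $\alpha_n(a,b)\neq 0$ for some $a,b\in V$. Then: (1) If $\alpha_\lambda(a,b)=\sum_{i=0}^3\lambda^i\alpha_i(a,b)$ for all $a,b\in V$, then for all $a,b,c\in V$: \begin{align*} &\alpha_3(a\ast b,c)=\alpha_3(b\ast a,c)=\alpha_3(a,c\lhd b)=\alpha_3(b,a\rhd c),\\ &\alpha_2(a\ast b,c)-\alpha_2(a,c\lhd b)-\beta\alpha_3(a,c\lhd b)-\alpha_3(a,b\circ c)=\alpha_3(b\circ a,c)-\alpha_3(a\circ b,c),\\ &2\alpha_2(a\ast b,c)-\alpha_2(b\ast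 a,c)-\alpha_2(a,b\star c)=3\alpha_3(b\circ a,c)-3\alpha_3(a\circ b,c),\\ &\alpha_1(a\ast b,c)-\alpha_1(a,c\lhd b)-\beta\alpha_2(a,c\lhd b)-\alpha_2(a,b\circ c)=\alpha_2(b\circ a,c)-\alpha_2(a\circ b,c),\\ &\alpha_1(a\ast b,c)-\alpha_1(b\ast a,c)-\alpha_1(a,b\star c)+\alpha_1(b,a\star c)=2\alpha_2(b\circ a,c)-2\alpha_2(a\circ b,c),\\ &\alpha_0(a\ast b,c)-\alpha_0(a,c\lhd b)+\alpha_0(b,a\star c)-\beta\alpha_1(a,c\lhd b)-\alpha_1(a,b\circ c)=\alpha_1(b\circ a,c)-\alpha_1(a\circ b,c),\\ &\alpha_0(a\circ b,c)-\beta\alpha_0(a,c\lhd b)-\alpha_0(a,b\circ c)=\alpha_0(b\circ a,c)-\beta\alpha_0(b,c\lhd a)-\alpha_0(b,a\circ c). \end{align*} (2) If $n>3$, then $\alpha_n(a\ast b,c)=\alpha_n(a,b\star c)=\alpha_n(a,b\lhd c)=\alpha_n(a,b\rhd c)=0$ for all $a,b,c\in V$. (3) $\alpha_\lambda(\cdot,\cdot)$ and $\alpha'_\lambda(\cdot,\cdot)$ (both defining central extensions of $R$ by $\mathbb{C}\mathfrak{c}_\beta$) are equivalent if and only if there is a linear map $\phi:V\to\mathbb{C}$ such that for all $a,b\in V$ $$\alpha_\lambda(a,b)=\alpha'_\lambda(a,b)+\beta\phi(b\lhd a)+\lambda\phi(a\star b)+\phi(a\circ b).$$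
   Context: All vector spaces are over $\mathbb{C}$. A left-symmetric algebra $(A,\circ)$ is a vector space with a bilinear product satisfying $(a\circ b)\circ c-a\circ(b\circ c)=(b\circ a)\circ c-b\circ(a\circ c)$. A left-symmetric conformal algebra is a $\mathbb{C}[\partial]$-module $R$ with a $\mathbb{C}$-bilinear map $R\times R\to R[\lambda]$, $(a,b)\mapsto a_\lambda b$, such that $\partial a_\lambda b=-\lambda a_\lambda b$, $a_\lambda\partial b=(\partial+\lambda)a_\lambda b$ (conformal sesquilinearity), and $(a_\lambda b)_{\lambda+\mu}c-a_\lambda(b_\mu c)=(b_\mu a)_{\lambda+\mu}c-b_\mu(a_\lambda c)$. A pre-Novikov algebra $(A,\lhd,\rhd)$ is a vector space with two bilinear operations such that for all $a,b,c\in A$: $a\rhd(b\rhd c)=(a\rhd b+a\lhd b)\rhd c+b\rhd(a\rhd c)-(b\rhd a+b\lhd a)\rhd c$; $a\rhd(b\lhd c)=(a\rhd b)\lhd c+b\lhd(a\lhd c+a\rhd c)-(b\lhd a)\lhd c$; $(a\lhd b+a\rhd b)\rhd c=(a\rhd c)\lhd b$; $(a\lhd b)\lhd c=(a\lhd c)\lhd b$. A pre-Gel'fand-Dorfman algebra $(A,\lhd,\rhd,\circ)$ is a vector space such that $(A,\lhd,\rhd)$ is a pre-Novikov algebra, $(A,\circ)$ is a left-symmetric algebra, and for all $a,b,c$: $c\lhd(a\circ b-b\circ a)-a\circ(c\lhd b)-(b\circ c)\lhd a=-b\circ(c\lhd a)-(a\circ c)\lhd b$; $(a\circ b-b\circ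 a)\rhd c+(a\lhd b+a\rhd b)\circ c=a\rhd(b\circ c)-b\circ(a\rhd c)+(a\circ c)\lhd b$. The quadratic left-symmetric conformal algebra corresponding to $(V,\lhd,\rhd,\circ)$ is the free $\mathbb{C}[\partial]$-module $R=\mathbb{C}[\partial]V=\mathbb{C}[\partial]\otimes V$ with $a_\lambda b=\partial(b\lhd a)+a\circ b+\lambda(a\rhd b+b\lhd a)$ for $a,b\in V$, extended by conformal sesquilinearity (this is a left-symmetric conformal algebra). Central extensions: a central extension of $R$ by $\mathbb{C}\mathfrak{c}_\beta$ is a left-symmetric conformal algebra structure on the $\mathbb{C}[\partial]$-module $\widehat{R}=R\oplus\mathbb{C}\mathfrak{c}_\beta$, $\partial\mathfrak{c}_\beta=\beta\mathfrak{c}_\beta$, with $\lambda$-product $\widehat{x_\lambda y}=x_\lambda y+\alpha_\lambda(x,y)\mathfrak{c}_\beta$ for $x,y\in R$ and all $\lambda$-products involving $\mathfrak{c}_\beta$ equal to zero, where $\alpha_\lambda:R\times R\to\mathbb{C}[\lambda]$ is $\mathbb{C}$-bilinear. By sesquilinearity ($\alpha_\lambda(\partial x,y)=-\lambda\alpha_\lambda(x,y)$, $\alpha_\lambda(x,\partial y)=(\lambda+\beta)\alpha_\lambda(x,y)$), $\alpha_\lambda$ is determined by its restriction to $V\times V$. Two such central extensions $\widehat{R}_1,\widehat{R}_2$ (given by $\alpha_\lambda,\alpha'_\lambda$) are equivalent if there is a left-symmetric conformal algebra homomorphism $\varphi:\widehat{R}_1\to\widehat{R}_2$ restricting to the identity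 on $\mathbb{C}\mathfrak{c}_\beta$ and inducing the identity on $R$; in that case $\alpha_\lambda$ and $\alpha'_\lambda$ are called equivalent. *)

theory Defs
  imports
    Complex_Main
    "HOL-Computational_Algebra.Polynomial"
    "HOL-Library.Product_Plus"
begin

definition bilinear_over ::
    "(complex \<Rightarrow> 'a::ab_group_add \<Rightarrow> 'a) \<Rightarrow> (complex \<Rightarrow> 'b::ab_group_add \<Rightarrow> 'b) \<Rightarrow>
     (complex \<Rightarrow> 'c::ab_group_add \<Rightarrow> 'c) \<Rightarrow> ('a \<Rightarrow> 'b \<Rightarrow> 'c) \<Rightarrow> bool" where
  "bilinear_over s1 s2 s3 f \<longleftrightarrow>
     (\<forall>y. Vector_Spaces.linear s1 s3 (\<lambda>x. f x y)) \<and> (\<forall>x. Vector_Spaces.linear s2 s3 (f x))"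


section \<open>Left-symmetric, pre-Novikov and pre-Gel'fand-Dorfman algebras\<close>

locale left_symmetric_algebra = vector_space scale
  for scale :: "complex \<Rightarrow> 'v::ab_group_add \<Rightarrow> 'v" +
  fixes circ :: "'v \<Rightarrow> 'v \<Rightarrow> 'v" (infixl "\<odot>" 70)
  assumes bilinear_circ: "bilinear_over scale scale scale (\<odot>)"
    and left_symmetric: "(a \<odot> b) \<odot> c - a \<odot> (b \<odot> c) = (b \<odot> a) \<odot> c - b \<odot> (a \<odot> c)"

locale pre_novikov_algebra = vector_space scale
  for scale :: "complex \<Rightarrow> 'v::ab_group_add \<Rightarrow> 'v" +
  fixes lhd :: "'v \<Rightarrow> 'v \<Rightarrow> 'v" (infixl "\<lhd>" 70)
    and rhd :: "'v \<Rightarrow> 'v \<Rightarrow> 'v" (infixl "\<rhd>" 70)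
  assumes bilinear_lhd: "bilinear_over scale scale scale (\<lhd>)"
    and bilinear_rhd: "bilinear_over scale scale scale (\<rhd>)"
    and rhd_rhd: "a \<rhd> (b \<rhd> c) = (a \<rhd> b + a \<lhd> b) \<rhd> c + b \<rhd> (a \<rhd> c) - (b \<rhd> a + b \<lhd> a) \<rhd> c"
    and rhd_lhd: "a \<rhd> (b \<lhd> c) = (a \<rhd> b) \<lhd> c + b \<lhd> (a \<lhd> c + a \<rhd> c) - (b \<lhd> a) \<lhd> c"
    and sum_rhd: "(a \<lhd> b + a \<rhd> b) \<rhd> c = (a \<rhd> c) \<lhd> b"
    and lhd_lhd: "(a \<lhd> b) \<lhd> c = (a \<lhd> c) \<lhd> b"

locale pre_gelfand_dorfman_algebra =
  pre_novikov_algebra scale lhd rhd + left_symmetric_algebra scale circ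
  for scale :: "complex \<Rightarrow> 'v::ab_group_add \<Rightarrow> 'v"
    and lhd :: "'v \<Rightarrow> 'v \<Rightarrow> 'v" (infixl "\<lhd>" 70)
    and rhd :: "'v \<Rightarrow> 'v \<Rightarrow> 'v" (infixl "\<rhd>" 70)
    and circ :: "'v \<Rightarrow> 'v \<Rightarrow> 'v" (infixl "\<odot>" 70) +
  assumes lhd_commutator:
      "c \<lhd> (a \<odot> b - b \<odot> a) - a \<odot> (c \<lhd> b) - (b \<odot> c) \<lhd> a = - (b \<odot> (c \<lhd> a)) - (a \<odot> c) \<lhd> b"
    and commutator_rhd:
      "(a \<odot> b - b \<odot> a) \<rhd> c + (a \<lhd> b + a \<rhd> b) \<odot> c = a \<rhd> (b \<odot> c) - b \<odot> (a \<rhd> c) + (a \<odot> c) \<lhd> b"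


section \<open>Left-symmetric conformal algebras\<close>

text \<open>
  A \<open>\<complex>[\<partial>]\<close>-module is given by its scalar multiplication \<open>sc :: complex poly \<Rightarrow> 'r \<Rightarrow> 'r\<close>, so that
  \<open>\<partial>\<close> acts as \<open>sc [:0, 1:]\<close> and a complex number \<open>z\<close> acts as \<open>sc [:z:]\<close>. Elements of \<open>R[\<lambda>]\<close> are
  represented in \<open>'r poly\<close>, elements of \<open>R[\<lambda>, \<mu>]\<close> in \<open>'r poly poly\<close>; in the latter, and in
  \<open>complex poly poly\<close> for \<open>\<complex>[\<lambda>, \<mu>]\<close>, the inner indeterminate is \<open>\<lambda>\<close> and the outer one is \<open>\<mu>\<close>.
\<close>

abbreviation lam :: "complex poly poly" where "lam \<equiv> [:[:0, 1:]:]"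
abbreviation mu :: "complex poly poly" where "mu \<equiv> [:0, 1:]"

text \<open>The element \<open>p \<otimes> r\<close> of \<open>R[\<lambda>, \<mu>] = \<complex>[\<lambda>, \<mu>] \<otimes> R\<close>.\<close>

definition tensor2 :: "(complex poly \<Rightarrow> 'r::ab_group_add \<Rightarrow> 'r) \<Rightarrow> complex poly poly \<Rightarrow> 'r \<Rightarrow> 'r poly poly" where
  "tensor2 sc p r = map_poly (map_poly (\<lambda>z. sc [:z:] r)) p"

text \<open>For \<open>p, q \<in> \<complex>[\<lambda>, \<mu>]\<close>: \<open>nest_left\<close> is \<open>(a\<^sub>p b)\<^sub>q c\<close> and \<open>nest_right\<close> is \<open>a\<^sub>p (b\<^sub>q c)\<close>.\<close>

definition nest_left ::
    "(complex poly \<Rightarrow> 'r::ab_group_add \<Rightarrow> 'r) \<Rightarrow> ('r \<Rightarrow> 'r \<Rightarrow> 'r poly) \<Rightarrow>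
     'r \<Rightarrow> complex poly poly \<Rightarrow> 'r \<Rightarrow> complex poly poly \<Rightarrow> 'r \<Rightarrow> 'r poly poly" where
  "nest_left sc lprod a p b q c =
     (\<Sum>i\<le>degree (lprod a b). \<Sum>j\<le>degree (lprod (coeff (lprod a b) i) c).
        tensor2 sc (p ^ i * q ^ j) (coeff (lprod (coeff (lprod a b) i) c) j))"

definition nest_right ::
    "(complex poly \<Rightarrow> 'r::ab_group_add \<Rightarrow> 'r) \<Rightarrow> ('r \<Rightarrow> 'r \<Rightarrow> 'r poly) \<Rightarrow>
     'r \<Rightarrow> complex poly poly \<Rightarrow> 'r \<Rightarrow> complex poly poly \<Rightarrow> 'r \<Rightarrow> 'r poly poly" where
  "nest_right sc lprod a p b q c =
     (\<Sum>j\<le>degree (lprod b c). \<Sum>i\<le>degree (lprod a (coeff (lprod b c) j)).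
        tensor2 sc (p ^ i * q ^ j) (coeff (lprod a (coeff (lprod b c) j)) i))"

locale left_symmetric_conformal_algebra = module sc
  for sc :: "complex poly \<Rightarrow> 'r::ab_group_add \<Rightarrow> 'r" +
  fixes lprod :: "'r \<Rightarrow> 'r \<Rightarrow> 'r poly"
  assumes bilinear_lprod:
      "bilinear_over (\<lambda>z. sc [:z:]) (\<lambda>z. sc [:z:]) (\<lambda>z. map_poly (sc [:z:])) lprod"
    and sesquilinear_left: "lprod (sc [:0, 1:] a) b = - pCons 0 (lprod a b)"
    and sesquilinear_right:
      "lprod a (sc [:0, 1:] b) = map_poly (sc [:0, 1:]) (lprod a b) + pCons 0 (lprod a b)"
    and left_symmetric_conformal:
      "nest_left sc lprod a lam b (lam + mu) c - nest_right sc lprod a lam b mu c =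
       nest_left sc lprod b mu a (lam + mu) c - nest_right sc lprod b mu a lam c"

definition lsca_hom ::
    "(complex poly \<Rightarrow> 'r::ab_group_add \<Rightarrow> 'r) \<Rightarrow> ('r \<Rightarrow> 'r \<Rightarrow> 'r poly) \<Rightarrow>
     (complex poly \<Rightarrow> 's::ab_group_add \<Rightarrow> 's) \<Rightarrow> ('s \<Rightarrow> 's \<Rightarrow> 's poly) \<Rightarrow> ('r \<Rightarrow> 's) \<Rightarrow> bool" where
  "lsca_hom sc1 lprod1 sc2 lprod2 f \<longleftrightarrow>
     module_hom sc1 sc2 f \<and> (\<forall>x y. map_poly f (lprod1 x y) = lprod2 (f x) (f y))"


section \<open>The quadratic left-symmetric conformal algebra\<close>

text \<open>
  The free module \<open>R = \<complex>[\<partial>]V\<close> is represented in \<open>'v poly\<close>, with indeterminate \<open>\<partial>\<close>; thus \<open>a \<in> V\<close>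
  is the constant polynomial \<open>[:a:]\<close>, and \<open>R[\<lambda>]\<close> is \<open>'v poly poly\<close> with inner indeterminate \<open>\<partial>\<close>
  and outer indeterminate \<open>\<lambda>\<close>.
\<close>

definition free_act :: "(complex \<Rightarrow> 'v::ab_group_add \<Rightarrow> 'v) \<Rightarrow> complex poly \<Rightarrow> 'v poly \<Rightarrow> 'v poly" where
  "free_act scale p x =
     (\<Sum>i\<le>degree p. \<Sum>j\<le>degree x. monom (scale (coeff p i) (coeff x j)) (i + j))"

text \<open>
  For \<open>x = \<Sum>\<^sub>i \<partial>\<^sup>i a\<^sub>i\<close> and \<open>y = \<Sum>\<^sub>j \<partial>\<^sup>j b\<^sub>j\<close>, sesquilinearity forces
  \<open>x\<^sub>\<lambda> y = \<Sum>\<^sub>i \<Sum>\<^sub>j (-\<lambda>)\<^sup>i (\<partial> + \<lambda>)\<^sup>j ((a\<^sub>i)\<^sub>\<lambda> b\<^sub>j)\<close>. On \<open>R[\<lambda>]\<close>, multiplication by \<open>\<lambda>\<close> is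
  \<open>pCons 0\<close> and multiplication by \<open>\<partial>\<close> is \<open>map_poly (pCons 0)\<close>.
\<close>

definition quadratic_base ::
    "('v \<Rightarrow> 'v \<Rightarrow> 'v::ab_group_add) \<Rightarrow> ('v \<Rightarrow> 'v \<Rightarrow> 'v) \<Rightarrow> ('v \<Rightarrow> 'v \<Rightarrow> 'v) \<Rightarrow> 'v \<Rightarrow> 'v \<Rightarrow> 'v poly poly" where
  "quadratic_base lhd rhd circ a b = [: [:circ a b, lhd b a:], [:rhd a b + lhd b a:] :]"

definition quadratic_lprod ::
    "('v \<Rightarrow> 'v \<Rightarrow> 'v::ab_group_add) \<Rightarrow> ('v \<Rightarrow> 'v \<Rightarrow> 'v) \<Rightarrow> ('v \<Rightarrow> 'v \<Rightarrow> 'v) \<Rightarrow>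
     'v poly \<Rightarrow> 'v poly \<Rightarrow> 'v poly poly" where
  "quadratic_lprod lhd rhd circ x y =
     (\<Sum>i\<le>degree x. \<Sum>j\<le>degree y.
        ((\<lambda>f. - pCons 0 f) ^^ i) (((\<lambda>f. map_poly (pCons 0) f + pCons 0 f) ^^ j)
          (quadratic_base lhd rhd circ (coeff x i) (coeff y j))))"


section \<open>Central extensions by a one-dimensional module\<close>

text \<open>
  The pair \<open>(x, z)\<close> represents \<open>x + z c\<^sub>\<beta>\<close>; since \<open>\<partial>\<close> acts on \<open>c\<^sub>\<beta>\<close> as \<open>\<beta>\<close>, a polynomial
  \<open>p \<in> \<complex>[\<partial>]\<close> acts on it as \<open>p(\<beta>)\<close>.
\<close>

definition ext_act :: "(complex poly \<Rightarrow> 'r \<Rightarrow> 'r) \<Rightarrow> complex \<Rightarrow> complex poly \<Rightarrow> 'r \<times> complex \<Rightarrow> 'r \<times> complex" where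
  "ext_act sc \<beta> p u = (sc p (fst u), poly p \<beta> * snd u)"

definition ext_lprod ::
    "('r \<Rightarrow> 'r \<Rightarrow> 'r::ab_group_add poly) \<Rightarrow> ('r \<Rightarrow> 'r \<Rightarrow> complex poly) \<Rightarrow>
     'r \<times> complex \<Rightarrow> 'r \<times> complex \<Rightarrow> ('r \<times> complex) poly" where
  "ext_lprod lprod \<alpha> u v =
     map_poly (\<lambda>r. (r, 0)) (lprod (fst u) (fst v)) + map_poly (\<lambda>z. (0, z)) (\<alpha> (fst u) (fst v))"

definition central_extension ::
    "(complex poly \<Rightarrow> 'r::ab_group_add \<Rightarrow> 'r) \<Rightarrow> ('r \<Rightarrow> 'r \<Rightarrow> 'r poly) \<Rightarrow> complex \<Rightarrow>
     ('r \<Rightarrow> 'r \<Rightarrow> complex poly) \<Rightarrow> bool" where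
  "central_extension sc lprod \<beta> \<alpha> \<longleftrightarrow>
     bilinear_over (\<lambda>z. sc [:z:]) (\<lambda>z. sc [:z:]) smult \<alpha> \<and>
     left_symmetric_conformal_algebra (ext_act sc \<beta>) (ext_lprod lprod \<alpha>)"

definition equivalent_extensions ::
    "(complex poly \<Rightarrow> 'r::ab_group_add \<Rightarrow> 'r) \<Rightarrow> ('r \<Rightarrow> 'r \<Rightarrow> 'r poly) \<Rightarrow> complex \<Rightarrow>
     ('r \<Rightarrow> 'r \<Rightarrow> complex poly) \<Rightarrow> ('r \<Rightarrow> 'r \<Rightarrow> complex poly) \<Rightarrow> bool" where
  "equivalent_extensions sc lprod \<beta> \<alpha> \<alpha>' \<longleftrightarrow>
     (\<exists>f. lsca_hom (ext_act sc \<beta>) (ext_lprod lprod \<alpha>) (ext_act sc \<beta>) (ext_lprod lprod \<alpha>') f \<and>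
          (\<forall>z. f (0, z) = (0, z)) \<and> (\<forall>x z. fst (f (x, z)) = x))"

end

theory Submission
  imports Defs
begin

text \<open>
  The product of a central extension \<open>R \<oplus> \<complex>c\<^sub>\<beta>\<close> has two components, and every axiom of the extension
  splits accordingly. The \<open>R\<close>-component says that \<open>R\<close> itself is a module with a sesquilinear product.
  The \<open>c\<^sub>\<beta>\<close>-component says that \<open>\<alpha>\<^sub>\<lambda>\<close> is sesquilinear and satisfies the cocycle condition
  \<open>\<alpha>\<^bsub>\<lambda>+\<mu>\<^esub>(a\<^sub>\<lambda> b, c) - \<alpha>\<^sub>\<lambda>(a, b\<^sub>\<mu> c) = \<alpha>\<^bsub>\<lambda>+\<mu>\<^esub>(b\<^sub>\<mu> a, c) - \<alpha>\<^sub>\<mu>(b, a\<^sub>\<lambda> c)\<close>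
  (\<open>cocycle_condition\<close>).

  For \<open>a, b, c \<in> V\<close>, inserting the quadratic product and moving every \<open>\<partial>\<close> out of \<open>\<alpha>\<close> by
  sesquilinearity turns this, with \<open>a \<ast> b = a \<rhd> b + a \<lhd> b\<close> and \<open>a \<star> b = a \<rhd> b + b \<lhd> a\<close>, into the identity
  \<open>\<alpha>\<^bsub>\<lambda>+\<mu>\<^esub>(a \<circ> b - b \<circ> a, c) + \<lambda> \<alpha>\<^bsub>\<lambda>+\<mu>\<^esub>(a \<ast> b, c) - \<mu> \<alpha>\<^bsub>\<lambda>+\<mu>\<^esub>(b \<ast> a, c)
    = (\<lambda> + \<beta>) \<alpha>\<^sub>\<lambda>(a, c \<lhd> b) + \<alpha>\<^sub>\<lambda>(a, b \<circ> c) + \<mu> \<alpha>\<^sub>\<lambda>(a, b \<star> c)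
      - (\<mu> + \<beta>) \<alpha>\<^sub>\<mu>(b, c \<lhd> a) - \<alpha>\<^sub>\<mu>(b, a \<circ> c) - \<lambda> \<alpha>\<^sub>\<mu>(b, a \<star> c)\<close>
  in \<open>\<complex>[\<lambda>, \<mu>]\<close>. The theorem \<open>cf_cocycle\<close> is its coefficient at \<open>\<lambda>\<^sup>i \<mu>\<^sup>j\<close>, the powers of \<open>\<lambda> + \<mu>\<close>
  contributing the binomial coefficients.

  The equations in degree at most 3 are the coefficients of total degree at most 4. If the degree is
  \<open>n > 3\<close>, then the two monomials \<open>\<lambda>\<^bsup>n-1\<^esup>\<mu>\<^sup>2\<close> and \<open>\<lambda>\<^sup>2\<mu>\<^bsup>n-1\<^esup>\<close> do not occur on the right, so that
  \<open>x = \<alpha>\<^sub>n(a \<ast> b, c)\<close> and \<open>y = \<alpha>\<^sub>n(b \<ast> a, c)\<close> satisfy \<open>k x = n y\<close> and \<open>n x = k y\<close>, where \<open>k\<close> is the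
  binomial coefficient of \<open>n\<close> over 2. As \<open>k > n\<close>, both vanish; for \<open>n = 3\<close> one has \<open>k = n\<close> and only \<open>x = y\<close> follows. The
  monomials \<open>\<lambda>\<^bsup>n+1\<^esup>\<close> and \<open>\<lambda>\<^sup>n\<mu>\<close> then give the remaining assertions.

  An equivalence of extensions has the form \<open>(x, z) \<mapsto> (x, \<psi> x + z)\<close> for a homomorphism of
  \<open>\<complex>[\<partial>]\<close>-modules \<open>\<psi> : R \<rightarrow> \<complex>c\<^sub>\<beta>\<close> (\<open>equivalent_extensions_iff\<close>). Since \<open>R\<close> is free, such \<open>\<psi>\<close> correspond
  to linear functionals on \<open>V\<close>, and since both sides of the compatibility with the products are
  sesquilinear, it is enough to compare them on \<open>V\<close>; the functional \<open>\<phi>\<close> is the restriction of \<open>-\<psi>\<close>.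
\<close>

section \<open>Coefficients in two variables\<close>

text \<open>
  \<open>subst2 A p\<close> is \<open>A(p) \<in> \<complex>[\<lambda>, \<mu>]\<close>; thus \<open>\<alpha>\<^bsub>\<lambda>+\<mu>\<^esub>(x, y)\<close> is \<open>subst2 (\<alpha> x y) (lam + mu)\<close>.
\<close>

definition subst2 :: "complex poly \<Rightarrow> complex poly poly \<Rightarrow> complex poly poly" where
  "subst2 A p = poly (map_poly (\<lambda>z. [:[:z:]:]) A) p"

lemma subst2_0 [simp]: "subst2 0 p = 0"
  by (simp add: subst2_def)

lemma subst2_pCons [simp]: "subst2 (pCons z A) p = [:[:z:]:] + p * subst2 A p"
  by (simp add: subst2_def map_poly_pCons)

lemma subst2_add: "subst2 (A + B) p = subst2 A p + subst2 B p"
proof -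
  have "map_poly (\<lambda>z. [:[:z:]:]) (A + B)
      = map_poly (\<lambda>z. [:[:z:]:]) A + map_poly (\<lambda>z. [:[:z::complex:]:]) B"
    by (rule poly_eqI) (simp add: coeff_map_poly)
  then show ?thesis
    by (simp add: subst2_def)
qed

lemma subst2_minus: "subst2 (- A) p = - subst2 A p"
  using subst2_add[of A "- A" p] by (simp add: add_eq_0_iff2)

lemma subst2_diff: "subst2 (A - B) p = subst2 A p - subst2 B p"
  using subst2_add[of A "- B" p] by (simp add: subst2_minus)

lemma subst2_smult: "subst2 (smult z A) p = smult [:z:] (subst2 A p)"
  by (induction A) (simp_all add: smult_add_right mult.commute)

lemma subst2_eq_sum: "subst2 A p = (\<Sum>k\<le>degree A. smult [:coeff A k:] (p ^ k))"
proof -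
  have "degree (map_poly (\<lambda>z. [:[:z:]:]) A) = degree A"
    by (rule degree_map_poly) simp
  then show ?thesis
    by (simp add: subst2_def poly_altdef coeff_map_poly)
qed

text \<open>The inner variable is \<open>\<lambda>\<close>, so this is the coefficient at \<open>\<lambda>\<^sup>i \<mu>\<^sup>j\<close>.\<close>

definition coeff2 :: "complex poly poly \<Rightarrow> nat \<Rightarrow> nat \<Rightarrow> complex" where
  "coeff2 F i j = coeff (coeff F j) i"

lemma coeff2_add: "coeff2 (F + G) i j = coeff2 F i j + coeff2 G i j"
  and coeff2_diff: "coeff2 (F - G) i j = coeff2 F i j - coeff2 G i j"
  and coeff2_smult: "coeff2 (smult [:z:] F) i j = z * coeff2 F i j"
  and coeff2_lam_mult: "coeff2 (lam * F) i j = (if i = 0 then 0 else coeff2 F (i - 1) j)"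
  and coeff2_mu_mult: "coeff2 (mu * F) i j = (if j = 0 then 0 else coeff2 F i (j - 1))"
  by (auto simp: coeff2_def coeff_pCons split: nat.split)

lemma coeff2_sum: "coeff2 (\<Sum>k\<in>K. F k) i j = (\<Sum>k\<in>K. coeff2 (F k) i j)"
  by (simp add: coeff2_def coeff_sum)

lemma coeff2_subst2:
  "coeff2 (subst2 A p) i j = (\<Sum>k\<le>degree A. coeff A k * coeff2 (p ^ k) i j)"
  by (simp add: subst2_eq_sum coeff2_sum coeff2_smult)

text \<open>
  For each of the three substitutions \<open>\<lambda>\<close>, \<open>\<mu>\<close> and \<open>\<lambda> + \<mu>\<close>, a given monomial occurs in at most one
  power, so a coefficient of \<open>A(p)\<close> involves a single coefficient of \<open>A\<close>.
\<close>

lemma coeff2_subst2_single: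
  assumes "\<And>k. coeff2 (p ^ k) i j = (if k = m then w else 0)"
  shows "coeff2 (subst2 A p) i j = w * coeff A m"
proof -
  have "coeff2 (subst2 A p) i j = (\<Sum>k\<le>degree A. if k = m then w * coeff A m else 0)"
    unfolding coeff2_subst2 assms by (rule sum.cong) auto
  also have "\<dots> = w * coeff A m"
    by (auto simp: coeff_eq_0)
  finally show ?thesis .
qed

lemma coeff2_subst2_lam: "coeff2 (subst2 A lam) i j = (if j = 0 then coeff A i else 0)"
proof -
  have "lam ^ k = [:monom 1 k:]" for k
    by (induction k) (simp_all add: monom_Suc one_pCons monom_0 monom_Suc)
  then have "coeff2 (lam ^ k) i j = (if k = i then (if j = 0 then 1 else 0) else 0)" for k
    by (auto simp: coeff2_def coeff_pCons split: nat.split)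
  from coeff2_subst2_single[OF this] show ?thesis
    by simp
qed

lemma coeff2_subst2_mu: "coeff2 (subst2 A mu) i j = (if i = 0 then coeff A j else 0)"
proof -
  have "mu ^ k = monom 1 k" for k
    by (simp add: monom_altdef)
  then have "coeff2 (mu ^ k) i j = (if k = j then (if i = 0 then 1 else 0) else 0)" for k
    by (auto simp: coeff2_def one_pCons coeff_pCons split: nat.split)
  from coeff2_subst2_single[OF this] show ?thesis
    by simp
qed

lemma coeff2_subst2_sum:
  "coeff2 (subst2 A (lam + mu)) i j = of_nat ((i + j) choose j) * coeff A (i + j)"
proof (rule coeff2_subst2_single)
  fix k
  have "coeff ([:[:0, 1:], 1:] ^ k) j = of_nat (k choose j) * monom (1::complex) (k - j)"
  proof (cases "j \<le> k")
    case True
    then show ?thesis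
      by (simp add: coeff_linear_poly_power monom_altdef)
  next
    case False
    then have "degree ([:[:0, 1::complex:], 1:] ^ k) < j"
      using degree_power_le[of "[:[:0, 1::complex:], 1:]" k] by simp
    with False show ?thesis
      by (simp add: coeff_eq_0 binomial_eq_0)
  qed
  then show "coeff2 ((lam + mu) ^ k) i j = (if k = i + j then of_nat ((i + j) choose j) else 0)"
    by (auto simp: coeff2_def of_nat_poly binomial_eq_0_iff)
qed


section \<open>The cocycle condition of a central extension\<close>

lemma map_poly2_sum:
  assumes "additive \<psi>"
  shows "map_poly (map_poly \<psi>) (\<Sum>k\<in>K. F k) = (\<Sum>k\<in>K. map_poly (map_poly \<psi>) (F k))"
proof -
  interpret additive \<psi> by (fact assms)
  show ?thesis
    by (intro poly_eqI) (simp add: coeff_map_poly coeff_sum zero sum)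
qed

lemma map_poly_tensor2:
  assumes "additive \<psi>" and "\<And>z. \<psi> (sc [:z:] r) = z * \<psi> r" and "sc 0 r = 0"
  shows "map_poly (map_poly \<psi>) (tensor2 sc p r) = smult [:\<psi> r:] p"
proof -
  interpret additive \<psi> by (fact assms)
  show ?thesis
    by (intro poly_eqI) (simp add: coeff_map_poly zero tensor2_def assms mult.commute)
qed

text \<open>
  A functional \<open>\<psi>\<close> on the coefficients turns the inner sum of a nested product into a substitution:
  the coefficients of \<open>a\<^sub>p b\<close> remain as arguments of the outer product, and the outer product only
  enters through its image under \<open>\<psi>\<close>.
\<close>

lemma map_poly_nest:
  fixes \<psi> :: "'r::ab_group_add \<Rightarrow> complex"
  assumes \<psi>: "additive \<psi>" and hom: "\<And>z r. \<psi> (sc [:z:] r) = z * \<psi> r"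
    and sc_0: "\<And>r. sc 0 r = 0"
  shows "map_poly (map_poly \<psi>) (nest_left sc l a p b q c)
      = (\<Sum>i\<le>degree (l a b). p ^ i * subst2 (map_poly \<psi> (l (coeff (l a b) i) c)) q)" (is ?left)
    and "map_poly (map_poly \<psi>) (nest_right sc l a p b q c)
      = (\<Sum>j\<le>degree (l b c). q ^ j * subst2 (map_poly \<psi> (l a (coeff (l b c) j))) p)" (is ?right)
proof -
  interpret additive \<psi> by (fact \<psi>)
  have subst: "subst2 (map_poly \<psi> F) w = (\<Sum>k\<le>degree F. smult [:\<psi> (coeff F k):] (w ^ k))" for F w
  proof -
    have "subst2 (map_poly \<psi> F) w = (\<Sum>k\<le>degree (map_poly \<psi> F). smult [:\<psi> (coeff F k):] (w ^ k))"
      by (simp add: subst2_eq_sum coeff_map_poly zero)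
    also have "\<dots> = (\<Sum>k\<le>degree F. smult [:\<psi> (coeff F k):] (w ^ k))"
    proof (rule sum.mono_neutral_left)
      show "\<forall>k\<in>{..degree F} - {..degree (map_poly \<psi> F)}. smult [:\<psi> (coeff F k):] (w ^ k) = 0"
      proof
        fix k assume "k \<in> {..degree F} - {..degree (map_poly \<psi> F)}"
        then have "coeff (map_poly \<psi> F) k = 0" by (simp add: coeff_eq_0)
        then show "smult [:\<psi> (coeff F k):] (w ^ k) = 0" by (simp add: coeff_map_poly zero)
      qed
    qed (auto simp: map_poly_degree_leq)
    finally show ?thesis .
  qed
  have tensor: "map_poly (map_poly \<psi>) (tensor2 sc w r) = smult [:\<psi> r:] w" for w r
    by (rule map_poly_tensor2) (auto simp: assms)
  show ?left
    unfolding nest_left_def subst map_poly2_sum[OF \<psi>] tensor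
    by (simp add: sum_distrib_left)
  show ?right
    unfolding nest_right_def subst map_poly2_sum[OF \<psi>] tensor
    by (simp add: sum_distrib_left mult.commute)
qed

lemma coeff_ext_lprod:
  "coeff (ext_lprod l \<alpha> u v) k = (coeff (l (fst u) (fst v)) k, coeff (\<alpha> (fst u) (fst v)) k)"
  by (simp add: ext_lprod_def coeff_map_poly zero_prod_def)

lemma map_poly_snd_ext_lprod: "map_poly snd (ext_lprod l \<alpha> u v) = \<alpha> (fst u) (fst v)"
  by (rule poly_eqI) (simp add: coeff_map_poly coeff_ext_lprod)

locale conformal_central_extension =
  fixes sc :: "complex poly \<Rightarrow> 'r::ab_group_add \<Rightarrow> 'r" and lprod :: "'r \<Rightarrow> 'r \<Rightarrow> 'r poly"
    and \<beta> :: complex and \<alpha> :: "'r \<Rightarrow> 'r \<Rightarrow> complex poly"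
  assumes ext: "central_extension sc lprod \<beta> \<alpha>"
begin

sublocale E: left_symmetric_conformal_algebra "ext_act sc \<beta>" "ext_lprod lprod \<alpha>"
  using ext by (simp add: central_extension_def)

lemma cocycle_linear:
  "\<alpha> (x + y) z = \<alpha> x z + \<alpha> y z" "\<alpha> z (x + y) = \<alpha> z x + \<alpha> z y"
  using ext unfolding central_extension_def bilinear_over_def
  by (auto simp: Vector_Spaces.linear_iff)

lemma cocycle_zero [simp]: "\<alpha> 0 z = 0" "\<alpha> z 0 = 0"
  using cocycle_linear(1,2)[of 0 0 z] cocycle_linear(1,2)[of z 0 0] by auto

text \<open>The \<open>R\<close>-components of the axioms of the extension are the corresponding properties of \<open>R\<close>.\<close>

lemma base_module: "module sc"
proof (rule module.intro)
  fix p q :: "complex poly" and x y :: 'r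
  show "sc p (x + y) = sc p x + sc p y"
    using E.scale_right_distrib[of p "(x, 0)" "(y, 0)"] by (simp add: ext_act_def)
  show "sc (p + q) x = sc p x + sc q x"
    using E.scale_left_distrib[of p q "(x, 0)"] by (simp add: ext_act_def)
  show "sc p (sc q x) = sc (p * q) x"
    using E.scale_scale[of p q "(x, 0)"] by (simp add: ext_act_def)
  show "sc 1 x = x"
    using E.scale_one[of "(x, 0)"] by (simp add: ext_act_def)
qed

sublocale R: module sc
  by (fact base_module)

lemma lprod_add: "lprod (x + y) z = lprod x z + lprod y z" "lprod z (x + y) = lprod z x + lprod z y"
proof -
  let ?l = "ext_lprod lprod \<alpha>"
  have "?l (u + w) v = ?l u v + ?l w v" "?l v (u + w) = ?l v u + ?l v w" for u v w
    using E.bilinear_lprod unfolding bilinear_over_def Vector_Spaces.linear_iff by blast+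
  from this(1)[of "(x, 0)" "(y, 0)" "(z, 0)"] this(2)[of "(z, 0)" "(x, 0)" "(y, 0)"]
  show "lprod (x + y) z = lprod x z + lprod y z" "lprod z (x + y) = lprod z x + lprod z y"
    by (simp_all add: poly_eq_iff coeff_ext_lprod)
qed

lemma lprod_zero [simp]: "lprod 0 z = 0" "lprod z 0 = 0"
  using lprod_add(1)[of 0 0 z] lprod_add(2)[of z 0 0] by auto

lemma sesquilinear:
  "\<alpha> (sc [:0, 1:] x) y = - pCons 0 (\<alpha> x y)"
  "\<alpha> x (sc [:0, 1:] y) = smult \<beta> (\<alpha> x y) + pCons 0 (\<alpha> x y)"
  "lprod (sc [:0, 1:] x) y = - pCons 0 (lprod x y)"
  "lprod x (sc [:0, 1:] y) = map_poly (sc [:0, 1:]) (lprod x y) + pCons 0 (lprod x y)"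
proof -
  have left: "coeff (ext_lprod lprod \<alpha> (ext_act sc \<beta> [:0, 1:] (x, 0)) (y, 0)) k
      = coeff (- pCons 0 (ext_lprod lprod \<alpha> (x, 0) (y, 0))) k" for k
    by (simp add: E.sesquilinear_left)
  have right: "coeff (ext_lprod lprod \<alpha> (x, 0) (ext_act sc \<beta> [:0, 1:] (y, 0))) k
      = coeff (map_poly (ext_act sc \<beta> [:0, 1:]) (ext_lprod lprod \<alpha> (x, 0) (y, 0))
          + pCons 0 (ext_lprod lprod \<alpha> (x, 0) (y, 0))) k" for k
    by (simp add: E.sesquilinear_right)
  have [simp]: "ext_act sc \<beta> [:0, 1:] 0 = 0" by simp
  show "\<alpha> (sc [:0, 1:] x) y = - pCons 0 (\<alpha> x y)"
  proof (rule poly_eqI)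
    show "coeff (\<alpha> (sc [:0, 1:] x) y) k = coeff (- pCons 0 (\<alpha> x y)) k" for k
      using left[of k] by (cases k) (simp_all add: coeff_ext_lprod ext_act_def zero_prod_def)
  qed
  show "lprod (sc [:0, 1:] x) y = - pCons 0 (lprod x y)"
  proof (rule poly_eqI)
    show "coeff (lprod (sc [:0, 1:] x) y) k = coeff (- pCons 0 (lprod x y)) k" for k
      using left[of k] by (cases k) (simp_all add: coeff_ext_lprod ext_act_def zero_prod_def)
  qed
  show "\<alpha> x (sc [:0, 1:] y) = smult \<beta> (\<alpha> x y) + pCons 0 (\<alpha> x y)"
  proof (rule poly_eqI)
    show "coeff (\<alpha> x (sc [:0, 1:] y)) k = coeff (smult \<beta> (\<alpha> x y) + pCons 0 (\<alpha> x y)) k" for k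
      using right[of k]
      by (cases k) (simp_all add: coeff_map_poly coeff_ext_lprod ext_act_def zero_prod_def)
  qed
  show "lprod x (sc [:0, 1:] y) = map_poly (sc [:0, 1:]) (lprod x y) + pCons 0 (lprod x y)"
  proof (rule poly_eqI)
    show "coeff (lprod x (sc [:0, 1:] y)) k
        = coeff (map_poly (sc [:0, 1:]) (lprod x y) + pCons 0 (lprod x y)) k" for k
      using right[of k]
      by (cases k) (simp_all add: coeff_map_poly coeff_ext_lprod ext_act_def zero_prod_def)
  qed
qed

text \<open>
  This is the \<open>c\<^sub>\<beta>\<close>-component of left symmetry. The sums run over the coefficients of the inner products;
  the common bound \<open>N\<close> is there because the degree of a product in the extension, which is the bound
  used in the nested products, also depends on \<open>\<alpha>\<close>.
\<close>

lemma cocycle_condition: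
  assumes N: "degree (lprod a b) \<le> N" "degree (lprod b a) \<le> N" "degree (lprod b c) \<le> N"
      "degree (lprod a c) \<le> N"
  shows "(\<Sum>i\<le>N. lam ^ i * subst2 (\<alpha> (coeff (lprod a b) i) c) (lam + mu))
       - (\<Sum>j\<le>N. mu ^ j * subst2 (\<alpha> a (coeff (lprod b c) j)) lam)
       = (\<Sum>i\<le>N. mu ^ i * subst2 (\<alpha> (coeff (lprod b a) i) c) (lam + mu))
       - (\<Sum>j\<le>N. lam ^ j * subst2 (\<alpha> b (coeff (lprod a c) j)) mu)"
proof -
  let ?l = "ext_lprod lprod \<alpha>" and ?s = "ext_act sc \<beta>" and ?S = "map_poly (map_poly snd)"
  have additive_snd: "additive (snd :: 'r \<times> complex \<Rightarrow> complex)"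
    by (simp add: additive_def)
  have extend: "(\<Sum>i\<le>degree (?l (x, 0) (y, 0)). p ^ i * subst2 (G (coeff (lprod x y) i)) q)
      = (\<Sum>i\<le>N. p ^ i * subst2 (G (coeff (lprod x y) i)) q)"
    if "degree (lprod x y) \<le> N" and "G 0 = 0" for x y p q G
  proof -
    have zero: "coeff (lprod x y) i = 0" if "degree (?l (x, 0) (y, 0)) < i" for i
      using coeff_eq_0[OF that] by (simp add: coeff_ext_lprod zero_prod_def)
    let ?M = "max N (degree (?l (x, 0) (y, 0)))"
    have "(\<Sum>i\<le>m. p ^ i * subst2 (G (coeff (lprod x y) i)) q)
      = (\<Sum>i\<le>?M. p ^ i * subst2 (G (coeff (lprod x y) i)) q)"
      if "m \<le> ?M" and "\<And>i. m < i \<Longrightarrow> coeff (lprod x y) i = 0" for m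
      using that \<open>G 0 = 0\<close> by (intro sum.mono_neutral_left) auto
    from this[of N] this[of "degree (?l (x, 0) (y, 0))"] show ?thesis
      using \<open>degree (lprod x y) \<le> N\<close> zero by (simp add: coeff_eq_0)
  qed
  have left: "?S (nest_left ?s ?l (x, 0) p (y, 0) q (z, 0))
      = (\<Sum>i\<le>N. p ^ i * subst2 (\<alpha> (coeff (lprod x y) i) z) q)"
    if "degree (lprod x y) \<le> N" for x y z p q
    using extend[OF that, of "\<lambda>w. \<alpha> w z" p q]
    by (subst map_poly_nest[OF additive_snd])
      (simp_all add: ext_act_def map_poly_snd_ext_lprod coeff_ext_lprod zero_prod_def)
  have right: "?S (nest_right ?s ?l (x, 0) p (y, 0) q (z, 0))
      = (\<Sum>i\<le>N. q ^ i * subst2 (\<alpha> x (coeff (lprod y z) i)) p)"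
    if "degree (lprod y z) \<le> N" for x y z p q
    using extend[OF that, of "\<alpha> x" q p]
    by (subst map_poly_nest[OF additive_snd])
      (simp_all add: ext_act_def map_poly_snd_ext_lprod coeff_ext_lprod zero_prod_def)
  have diff: "?S (F - G) = ?S F - ?S G" for F G :: "('r \<times> complex) poly poly"
    by (intro poly_eqI) (simp add: coeff_map_poly)
  from arg_cong[OF E.left_symmetric_conformal[of "(a, 0)" "(b, 0)" "(c, 0)"], of ?S]
  show ?thesis
    by (simp only: diff left right N)
qed

end

section \<open>Equivalence of central extensions\<close>

text \<open>
  A homomorphism that fixes \<open>c\<^sub>\<beta>\<close> and induces the identity on \<open>R\<close> is determined by the \<open>c\<^sub>\<beta>\<close>-component
  \<open>\<psi>\<close> of its restriction to \<open>R\<close>. Because products with \<open>c\<^sub>\<beta>\<close> vanish, compatibility with the products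
  only compares \<open>\<alpha>'\<close> with \<open>\<alpha>\<close> plus the image of the product of \<open>R\<close> under \<open>\<psi>\<close>.
\<close>

theorem equivalent_extensions_iff:
  assumes ext: "central_extension sc lprod \<beta> \<alpha>" and ext': "central_extension sc lprod \<beta> \<alpha>'"
  shows "equivalent_extensions sc lprod \<beta> \<alpha> \<alpha>' \<longleftrightarrow>
    (\<exists>\<psi>. module_hom sc (\<lambda>p z. poly p \<beta> * z) \<psi> \<and> (\<forall>x y. \<alpha>' x y = \<alpha> x y + map_poly \<psi> (lprod x y)))"
proof -
  interpret e: conformal_central_extension sc lprod \<beta> \<alpha> by (unfold_locales) (fact ext)
  interpret e': conformal_central_extension sc lprod \<beta> \<alpha>' by (unfold_locales) (fact ext')
  show ?thesis
  proof
    assume "equivalent_extensions sc lprod \<beta> \<alpha> \<alpha>'"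
    then obtain f where hom: "module_hom (ext_act sc \<beta>) (ext_act sc \<beta>) f"
      and prod: "\<And>u v. map_poly f (ext_lprod lprod \<alpha> u v) = ext_lprod lprod \<alpha>' (f u) (f v)"
      and f: "\<And>z. f (0, z) = (0, z)" "\<And>x z. fst (f (x, z)) = x"
      unfolding equivalent_extensions_def lsca_hom_def by blast
    interpret f: module_hom "ext_act sc \<beta>" "ext_act sc \<beta>" f by (fact hom)
    define \<psi> where "\<psi> x = snd (f (x, 0))" for x
    have f_eq: "f (x, z) = (x, \<psi> x + z)" for x z
      using f.add[of "(x, 0)" "(0, z)"] f(2)[of x 0]
      by (cases "f (x, 0)") (auto simp: \<psi>_def f(1))
    have "module_hom sc (\<lambda>p z. poly p \<beta> * z) \<psi>"
    proof (unfold module_hom_iff, intro conjI allI)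
      show "module sc" by (fact e.base_module)
      show "module (\<lambda>p z. poly p \<beta> * z)"
        by unfold_locales (simp_all add: algebra_simps)
      show "\<psi> (x + y) = \<psi> x + \<psi> y" for x y
        using f.add[of "(x, 0)" "(y, 0)"] by (simp add: f_eq)
      show "\<psi> (sc p x) = poly p \<beta> * \<psi> x" for p x
        using f.scale[of p "(x, 0)"] by (simp add: f_eq ext_act_def)
    qed
    moreover have "\<alpha>' x y = \<alpha> x y + map_poly \<psi> (lprod x y)" for x y
    proof (rule poly_eqI)
      fix k
      interpret \<psi>: module_hom sc "\<lambda>p z. poly p \<beta> * z" \<psi> by fact
      have "coeff (map_poly f (ext_lprod lprod \<alpha> (x, 0) (y, 0))) k
          = coeff (ext_lprod lprod \<alpha>' (f (x, 0)) (f (y, 0))) k"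
        by (simp add: prod)
      then show "coeff (\<alpha>' x y) k = coeff (\<alpha> x y + map_poly \<psi> (lprod x y)) k"
        by (simp add: coeff_map_poly coeff_ext_lprod f_eq add.commute)
    qed
    ultimately show "\<exists>\<psi>. module_hom sc (\<lambda>p z. poly p \<beta> * z) \<psi> \<and>
        (\<forall>x y. \<alpha>' x y = \<alpha> x y + map_poly \<psi> (lprod x y))"
      by blast
  next
    assume "\<exists>\<psi>. module_hom sc (\<lambda>p z. poly p \<beta> * z) \<psi> \<and>
        (\<forall>x y. \<alpha>' x y = \<alpha> x y + map_poly \<psi> (lprod x y))"
    then obtain \<psi> where hom: "module_hom sc (\<lambda>p z. poly p \<beta> * z) \<psi>"
      and \<alpha>': "\<And>x y. \<alpha>' x y = \<alpha> x y + map_poly \<psi> (lprod x y)" by blast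
    interpret \<psi>: module_hom sc "\<lambda>p z. poly p \<beta> * z" \<psi> by (fact hom)
    define f where "f u = (fst u, \<psi> (fst u) + snd u)" for u
    have "f 0 = 0" by (simp add: f_def zero_prod_def)
    have "module_hom (ext_act sc \<beta>) (ext_act sc \<beta>) f"
      using e.E.module_axioms
      by (simp add: module_hom_iff f_def ext_act_def \<psi>.add \<psi>.scale algebra_simps)
    moreover have "map_poly f (ext_lprod lprod \<alpha> u v) = ext_lprod lprod \<alpha>' (f u) (f v)" for u v
    proof (rule poly_eqI)
      show "coeff (map_poly f (ext_lprod lprod \<alpha> u v)) k = coeff (ext_lprod lprod \<alpha>' (f u) (f v)) k" for k
        unfolding coeff_map_poly[of f, OF \<open>f 0 = 0\<close>]
        by (simp add: coeff_map_poly coeff_ext_lprod f_def \<alpha>')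
    qed
    ultimately show "equivalent_extensions sc lprod \<beta> \<alpha> \<alpha>'"
      unfolding equivalent_extensions_def lsca_hom_def by (intro exI[of _ f]) (simp add: f_def)
  qed
qed


section \<open>Cocycles of the quadratic algebra\<close>

lemma free_act_generators:
  assumes "vector_space scale"
  shows "free_act scale [:z:] x = map_poly (scale z) x"
    and "free_act scale [:0, 1:] x = pCons 0 x"
proof -
  interpret vector_space scale by (fact assms)
  have x: "x = (\<Sum>j\<le>degree x. monom (coeff x j) j)"
    by (simp add: poly_as_sum_of_monoms)
  show "free_act scale [:z:] x = map_poly (scale z) x"
    by (rule poly_eqI) (auto simp: free_act_def coeff_sum coeff_map_poly coeff_eq_0)
  have "free_act scale [:0, 1:] x = (\<Sum>j\<le>degree x. monom (coeff x j) (Suc j))"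
    by (simp add: free_act_def)
  also have "\<dots> = pCons 0 (\<Sum>j\<le>degree x. monom (coeff x j) j)"
    by (rule poly_eqI) (simp add: coeff_sum coeff_pCons split: nat.split)
  finally show "free_act scale [:0, 1:] x = pCons 0 x"
    using x by simp
qed

lemma quadratic_lprod_constants:
  "quadratic_lprod lhd rhd circ [:a:] [:b:] = quadratic_base lhd rhd circ a b"
  by (simp add: quadratic_lprod_def)

locale quadratic_central_extension =
  vector_space scale +
  conformal_central_extension "free_act scale" "quadratic_lprod lhd rhd circ" \<beta> \<alpha>
  for scale :: "complex \<Rightarrow> 'v::ab_group_add \<Rightarrow> 'v"
    and lhd :: "'v \<Rightarrow> 'v \<Rightarrow> 'v" (infixl "\<lhd>" 70)
    and rhd :: "'v \<Rightarrow> 'v \<Rightarrow> 'v" (infixl "\<rhd>" 70)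
    and circ :: "'v \<Rightarrow> 'v \<Rightarrow> 'v" (infixl "\<odot>" 70)
    and \<beta> :: complex
    and \<alpha> :: "'v poly \<Rightarrow> 'v poly \<Rightarrow> complex poly"
begin

definition cf :: "nat \<Rightarrow> 'v \<Rightarrow> 'v \<Rightarrow> complex" where
  "cf i a b = coeff (\<alpha> [:a:] [:b:]) i"

lemma act_generator: "free_act scale [:0, 1:] x = pCons 0 x"
  by (rule free_act_generators) (fact vector_space_axioms)

lemma act_constant: "free_act scale [:z:] x = map_poly (scale z) x"
  by (rule free_act_generators) (fact vector_space_axioms)

text \<open>
  With \<open>x \<in> \<complex>[\<partial>]V\<close> stored as a polynomial in \<open>\<partial>\<close>, \<open>pCons a x\<close> is \<open>a + \<partial>x\<close>. Sesquilinearity therefore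
  becomes a recursion on this polynomial with values on \<open>V\<close> as base case.
\<close>

lemma cocycle_pCons:
  "\<alpha> (pCons a x) y = \<alpha> [:a:] y - pCons 0 (\<alpha> x y)"
  "\<alpha> y (pCons a x) = \<alpha> y [:a:] + smult \<beta> (\<alpha> y x) + pCons 0 (\<alpha> y x)"
  using cocycle_linear(1)[of "[:a:]" "pCons 0 x" y] cocycle_linear(2)[of y "[:a:]" "pCons 0 x"]
    sesquilinear(1)[of x y] sesquilinear(2)[of y x]
  by (simp_all add: act_generator)

lemma lprod_pCons:
  fixes x y :: "'v poly" and a :: 'v
  defines "l \<equiv> quadratic_lprod (\<lhd>) (\<rhd>) (\<odot>)"
  shows "l (pCons a x) y = l [:a:] y - pCons 0 (l x y)"
    and "l y (pCons a x) = l y [:a:] + map_poly (pCons 0) (l y x) + pCons 0 (l y x)"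
  using lprod_add(1)[of "[:a:]" "pCons 0 x" y] lprod_add(2)[of y "[:a:]" "pCons 0 x"]
    sesquilinear(3)[of x y] sesquilinear(4)[of y x]
  by (simp_all add: act_generator[abs_def] l_def)

lemma cf_add: "cf i (a + b) c = cf i a c + cf i b c" "cf i c (a + b) = cf i c a + cf i c b"
  using cocycle_linear(1,2)[of "[:a:]" "[:b:]" "[:c:]"] cocycle_linear(1,2)[of "[:c:]" "[:a:]" "[:b:]"]
  by (simp_all add: cf_def)

lemma cf_diff: "cf i (a - b) c = cf i a c - cf i b c"
  using cf_add(1)[of i "a - b" b c] by simp

text \<open>
  On the left, \<open>b \<lhd> a\<close> enters twice: with factor \<open>-(\<lambda> + \<mu>)\<close> from the \<open>\<partial>\<close>-part of \<open>a\<^sub>\<lambda> b\<close>, and with factor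
  \<open>\<lambda>\<close> from its \<open>\<lambda>\<close>-part. What is left is \<open>-\<mu>\<close>, which combines with the term \<open>\<mu> (b \<rhd> a)\<close> of \<open>b\<^sub>\<mu> a\<close> moved over from
  the other side; this is how the products \<open>a \<ast> b\<close> and \<open>b \<ast> a\<close> arise.
\<close>

theorem cf_cocycle:
  "of_nat ((i + j) choose j) * cf (i + j) (a \<odot> b - b \<odot> a) c
     + (if i = 0 then 0 else of_nat ((i + j - 1) choose j) * cf (i + j - 1) (a \<rhd> b + a \<lhd> b) c)
     - (if j = 0 then 0 else of_nat ((i + j - 1) choose (j - 1)) * cf (i + j - 1) (b \<rhd> a + b \<lhd> a) c)
   = (if j = 0 then (if i = 0 then 0 else cf (i - 1) a (c \<lhd> b)) + \<beta> * cf i a (c \<lhd> b)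
          + cf i a (b \<odot> c) else 0)
     + (if j = 1 then cf i a (b \<rhd> c + c \<lhd> b) else 0)
     - (if i = 0 then (if j = 0 then 0 else cf (j - 1) b (c \<lhd> a)) + \<beta> * cf j b (c \<lhd> a)
          + cf j b (a \<odot> c) else 0)
     - (if i = 1 then cf j b (a \<rhd> c + c \<lhd> a) else 0)"
proof -
  have "degree (quadratic_lprod (\<lhd>) (\<rhd>) (\<odot>) [:x:] [:y:]) \<le> 1" for x y
    by (simp add: quadratic_lprod_constants quadratic_base_def)
  note eq = cocycle_condition[OF this this this this, of a b c]
  \<comment> \<open>The inner products of elements of \<open>V\<close> are linear in their parameter.\<close>
  have sums: "(\<Sum>k\<le>1. F k) = F 0 + F 1" for F :: "nat \<Rightarrow> complex poly poly"
    by simp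
  have "coeff2 (subst2 (\<alpha> [:a \<odot> b, b \<lhd> a:] [:c:]) (lam + mu)
        + lam * subst2 (\<alpha> [:a \<rhd> b + b \<lhd> a:] [:c:]) (lam + mu)) i j
      - coeff2 (subst2 (\<alpha> [:a:] [:b \<odot> c, c \<lhd> b:]) lam
        + mu * subst2 (\<alpha> [:a:] [:b \<rhd> c + c \<lhd> b:]) lam) i j
      = coeff2 (subst2 (\<alpha> [:b \<odot> a, a \<lhd> b:] [:c:]) (lam + mu)
        + mu * subst2 (\<alpha> [:b \<rhd> a + a \<lhd> b:] [:c:]) (lam + mu)) i j
      - coeff2 (subst2 (\<alpha> [:b:] [:a \<odot> c, c \<lhd> a:]) mu
        + lam * subst2 (\<alpha> [:b:] [:a \<rhd> c + c \<lhd> a:]) mu) i j"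
    using arg_cong[OF eq, of "\<lambda>F. coeff2 F i j"]
    unfolding sums
    by (simp add: quadratic_lprod_constants quadratic_base_def coeff2_diff)
  moreover have linear: "\<alpha> [:x, y:] [:c:] = \<alpha> [:x:] [:c:] - pCons 0 (\<alpha> [:y:] [:c:])"
    "\<alpha> [:c:] [:x, y:] = \<alpha> [:c:] [:x:] + smult \<beta> (\<alpha> [:c:] [:y:]) + pCons 0 (\<alpha> [:c:] [:y:])"
    for x y c
    by (rule cocycle_pCons)+
  have shift: "coeff2 (subst2 (pCons 0 A) p) i j = coeff2 (p * subst2 A p) i j" for A p
    by simp
  note expand = linear subst2_add subst2_diff subst2_smult shift coeff2_add coeff2_diff coeff2_smult
    coeff2_lam_mult coeff2_mu_mult coeff2_subst2_sum coeff2_subst2_lam coeff2_subst2_mu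
  ultimately show ?thesis
    unfolding expand
    by (cases i; cases j) (auto simp: algebra_simps cf_def[symmetric] cf_add cf_diff)
qed

text \<open>
  The monomials used are \<open>\<lambda>\<^sup>2\<mu>\<^sup>2\<close>, \<open>\<lambda>\<^sup>4\<close> and \<open>\<lambda>\<^sup>3\<mu>\<close> for the first three equations, and
  \<open>\<lambda>\<^sup>3, \<lambda>\<^sup>2\<mu>, \<lambda>\<^sup>2, \<lambda>\<mu>, \<lambda>, 1\<close> for the others. Monomials with a higher power of \<open>\<mu>\<close> than of \<open>\<lambda>\<close> only repeat
  these with \<open>a\<close> and \<open>b\<close> exchanged.
\<close>

theorem cocycle_equations_cubic:
  assumes cubic: "\<And>k a b. 3 < k \<Longrightarrow> cf k a b = 0"
  shows "cf 3 (a \<rhd> b + a \<lhd> b) c = cf 3 (b \<rhd> a + b \<lhd> a) c"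
    and "cf 3 (b \<rhd> a + b \<lhd> a) c = cf 3 a (c \<lhd> b)"
    and "cf 3 a (c \<lhd> b) = cf 3 b (a \<rhd> c)"
    and "cf 2 (a \<rhd> b + a \<lhd> b) c - cf 2 a (c \<lhd> b) - \<beta> * cf 3 a (c \<lhd> b) - cf 3 a (b \<odot> c)
      = cf 3 (b \<odot> a) c - cf 3 (a \<odot> b) c"
    and "2 * cf 2 (a \<rhd> b + a \<lhd> b) c - cf 2 (b \<rhd> a + b \<lhd> a) c - cf 2 a (b \<rhd> c + c \<lhd> b)
      = 3 * cf 3 (b \<odot> a) c - 3 * cf 3 (a \<odot> b) c"
    and "cf 1 (a \<rhd> b + a \<lhd> b) c - cf 1 a (c \<lhd> b) - \<beta> * cf 2 a (c \<lhd> b) - cf 2 a (b \<odot> c)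
      = cf 2 (b \<odot> a) c - cf 2 (a \<odot> b) c"
    and "cf 1 (a \<rhd> b + a \<lhd> b) c - cf 1 (b \<rhd> a + b \<lhd> a) c - cf 1 a (b \<rhd> c + c \<lhd> b)
        + cf 1 b (a \<rhd> c + c \<lhd> a)
      = 2 * cf 2 (b \<odot> a) c - 2 * cf 2 (a \<odot> b) c"
    and "cf 0 (a \<rhd> b + a \<lhd> b) c - cf 0 a (c \<lhd> b) + cf 0 b (a \<rhd> c + c \<lhd> a)
        - \<beta> * cf 1 a (c \<lhd> b) - cf 1 a (b \<odot> c)
      = cf 1 (b \<odot> a) c - cf 1 (a \<odot> b) c"
    and "cf 0 (a \<odot> b) c - \<beta> * cf 0 a (c \<lhd> b) - cf 0 a (b \<odot> c)
      = cf 0 (b \<odot> a) c - \<beta> * cf 0 b (c \<lhd> a) - cf 0 b (a \<odot> c)"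
proof -
  have diagonal: "cf 3 (a \<rhd> b + a \<lhd> b) c = cf 3 (b \<rhd> a + b \<lhd> a) c" for a b
    using cf_cocycle[of 2 2 a b c] by (simp add: cubic numeral_eq_Suc)
  have left: "cf 3 (a \<rhd> b + a \<lhd> b) c = cf 3 a (c \<lhd> b)" for a b
    using cf_cocycle[of 4 0 a b c] by (simp add: cubic)
  \<comment> \<open>The monomial \<open>\<lambda>\<^sup>3\<mu>\<close> gives \<open>\<alpha>\<^sub>3(a, b \<star> c) = (3 - 1) \<alpha>\<^sub>3(a \<ast> b, c)\<close>, and the part \<open>c \<lhd> b\<close> of \<open>b \<star> c\<close> accounts for one half.\<close>
  have right: "cf 3 (a \<rhd> b + a \<lhd> b) c = cf 3 a (b \<rhd> c)" for a b
    using cf_cocycle[of 3 1 a b c] diagonal[of a b] left[of a b]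
    by (simp add: cubic cf_add(2)[of 3 a "b \<rhd> c"])
  show "cf 3 (a \<rhd> b + a \<lhd> b) c = cf 3 (b \<rhd> a + b \<lhd> a) c"
    and "cf 3 (b \<rhd> a + b \<lhd> a) c = cf 3 a (c \<lhd> b)"
    and "cf 3 a (c \<lhd> b) = cf 3 b (a \<rhd> c)"
    using diagonal[of a b] left[of a b] right[of b a] by simp_all
  show "cf 2 (a \<rhd> b + a \<lhd> b) c - cf 2 a (c \<lhd> b) - \<beta> * cf 3 a (c \<lhd> b) - cf 3 a (b \<odot> c)
      = cf 3 (b \<odot> a) c - cf 3 (a \<odot> b) c"
    using cf_cocycle[of 3 0 a b c] by (simp add: cf_diff algebra_simps)
  show "2 * cf 2 (a \<rhd> b + a \<lhd> b) c - cf 2 (b \<rhd> a + b \<lhd> a) c - cf 2 a (b \<rhd> c + c \<lhd> b)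
      = 3 * cf 3 (b \<odot> a) c - 3 * cf 3 (a \<odot> b) c"
    using cf_cocycle[of 2 1 a b c] by (simp add: cf_diff algebra_simps eval_nat_numeral)
  show "cf 1 (a \<rhd> b + a \<lhd> b) c - cf 1 a (c \<lhd> b) - \<beta> * cf 2 a (c \<lhd> b) - cf 2 a (b \<odot> c)
      = cf 2 (b \<odot> a) c - cf 2 (a \<odot> b) c"
    using cf_cocycle[of 2 0 a b c] by (simp add: cf_diff algebra_simps eval_nat_numeral)
  show "cf 1 (a \<rhd> b + a \<lhd> b) c - cf 1 (b \<rhd> a + b \<lhd> a) c - cf 1 a (b \<rhd> c + c \<lhd> b)
        + cf 1 b (a \<rhd> c + c \<lhd> a)
      = 2 * cf 2 (b \<odot> a) c - 2 * cf 2 (a \<odot> b) c"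
    using cf_cocycle[of 1 1 a b c] by (simp add: cf_diff algebra_simps flip: numeral_2_eq_2)
  show "cf 0 (a \<rhd> b + a \<lhd> b) c - cf 0 a (c \<lhd> b) + cf 0 b (a \<rhd> c + c \<lhd> a)
        - \<beta> * cf 1 a (c \<lhd> b) - cf 1 a (b \<odot> c)
      = cf 1 (b \<odot> a) c - cf 1 (a \<odot> b) c"
    using cf_cocycle[of 1 0 a b c] by (simp add: cf_diff algebra_simps)
  show "cf 0 (a \<odot> b) c - \<beta> * cf 0 a (c \<lhd> b) - cf 0 a (b \<odot> c)
      = cf 0 (b \<odot> a) c - \<beta> * cf 0 b (c \<lhd> a) - cf 0 b (a \<odot> c)"
    using cf_cocycle[of 0 0 a b c] by (simp add: cf_diff algebra_simps)
qed

text \<open>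
  In total degree \<open>n + 1\<close> the right-hand side of the cocycle identity only has the monomials \<open>\<lambda>\<^bsup>n+1\<^esup>\<close>,
  \<open>\<lambda>\<^sup>n\<mu>\<close>, \<open>\<lambda>\<mu>\<^sup>n\<close> and \<open>\<mu>\<^bsup>n+1\<^esup>\<close>. For \<open>n > 3\<close> the coefficients at \<open>\<lambda>\<^bsup>n-1\<^esup>\<mu>\<^sup>2\<close> and \<open>\<lambda>\<^sup>2\<mu>\<^bsup>n-1\<^esup>\<close> are two
  independent linear relations between \<open>\<alpha>\<^sub>n(a \<ast> b, c)\<close> and \<open>\<alpha>\<^sub>n(b \<ast> a, c)\<close>.
\<close>

theorem top_coefficient_trivial:
  assumes "3 < n" and top: "\<And>a b. cf (Suc n) a b = 0"
  shows "cf n (a \<rhd> b + a \<lhd> b) c = 0" and "cf n a (b \<rhd> c + c \<lhd> b) = 0"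
    and "cf n a (b \<lhd> c) = 0" and "cf n a (b \<rhd> c) = 0"
proof -
  have product: "cf n (a \<rhd> b + a \<lhd> b) c = 0" for a b c
  proof -
    let ?x = "cf n (a \<rhd> b + a \<lhd> b) c" and ?y = "cf n (b \<rhd> a + b \<lhd> a) c"
    define k where "k = n choose 2"
    have "2 * k = n * (n - 1)"
      by (cases n) (simp_all add: k_def choose_two)
    moreover have "n * 3 \<le> n * (n - 1)"
      using \<open>3 < n\<close> by (intro mult_le_mono2) simp
    ultimately have "n < k"
      using \<open>3 < n\<close> by linarith
    have "n choose (n - 2) = k" "n choose (n - 1) = n"
      using binomial_symmetric[of 2 n] binomial_symmetric[of 1 n] \<open>3 < n\<close> by (simp_all add: k_def)
    moreover have "n - 1 + 2 = Suc n" "2 + (n - 1) = Suc n" "n - 1 - 1 = n - 2" "n - 1 \<noteq> 0" "n - 1 \<noteq> 1"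
      "n \<noteq> 2"
      using \<open>3 < n\<close> by simp_all
    ultimately have "of_nat k * ?x = of_nat n * ?y" "of_nat n * ?x = of_nat k * ?y"
      using cf_cocycle[of "n - 1" 2 a b c] cf_cocycle[of 2 "n - 1" a b c]
      by (simp_all only: top diff_Suc_1) (simp_all add: k_def)
    then have "of_nat (k * k) * ?x = of_nat (n * n) * ?x"
      by (simp add: mult.assoc)
    then have "?x = 0 \<or> of_nat (k * k) = (of_nat (n * n) :: complex)"
      by simp
    moreover have "k * k \<noteq> n * n"
      using \<open>n < k\<close> by (metis mult_strict_mono' less_irrefl zero_le)
    ultimately show ?thesis
      using of_nat_eq_iff by blast
  qed
  have lhd: "cf n a (c \<lhd> b) = 0" for a b c
    using cf_cocycle[of "Suc n" 0 a b c] \<open>3 < n\<close> by (simp add: top product)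
  have star: "cf n a (b \<rhd> c + c \<lhd> b) = 0" for a b c
    using cf_cocycle[of n 1 a b c] \<open>3 < n\<close> by (simp add: top product)
  show "cf n (a \<rhd> b + a \<lhd> b) c = 0" and "cf n a (b \<rhd> c + c \<lhd> b) = 0"
    and "cf n a (b \<lhd> c) = 0" and "cf n a (b \<rhd> c) = 0"
    using product lhd star[of a b c] by (simp_all add: cf_add(2))
qed

text \<open>
  Freeness of \<open>R\<close> gives the extension \<open>\<Sum>\<^sub>i \<partial>\<^sup>i a\<^sub>i \<mapsto> -\<Sum>\<^sub>i \<beta>\<^sup>i \<phi>(a\<^sub>i)\<close> of \<open>-\<phi>\<close> to a module homomorphism \<open>\<psi>\<close>. The
  relation between \<open>\<alpha>\<close>, \<open>\<alpha>'\<close> and \<open>\<psi>\<close> then spreads from \<open>V\<close> to \<open>R\<close>, first in the second and then in the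
  first argument, because its two sides obey the same sesquilinear recursion.
\<close>

theorem equivalent_iff_linear_functional:
  assumes ext': "central_extension (free_act scale) (quadratic_lprod (\<lhd>) (\<rhd>) (\<odot>)) \<beta> \<alpha>'"
  shows "equivalent_extensions (free_act scale) (quadratic_lprod (\<lhd>) (\<rhd>) (\<odot>)) \<beta> \<alpha> \<alpha>' \<longleftrightarrow>
    (\<exists>\<phi>. Vector_Spaces.linear scale (*) \<phi> \<and>
      (\<forall>a b. \<alpha> [:a:] [:b:] = \<alpha>' [:a:] [:b:] + [:\<beta> * \<phi> (b \<lhd> a):]
                + monom (\<phi> (a \<rhd> b + b \<lhd> a)) 1 + [:\<phi> (a \<odot> b):]))"
    (is "?equivalent \<longleftrightarrow> (\<exists>\<phi>. ?lin \<phi> \<and> ?coboundary \<phi>)")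
proof -
  let ?l = "quadratic_lprod (\<lhd>) (\<rhd>) (\<odot>)"
  let ?hom = "module_hom (free_act scale) (\<lambda>p z. poly p \<beta> * z)"
  interpret e': quadratic_central_extension scale "(\<lhd>)" "(\<rhd>)" "(\<odot>)" \<beta> \<alpha>'
    by unfold_locales (fact ext')
  have on_constants: "map_poly \<psi> (?l [:a:] [:b:])
      = [:\<psi> [:a \<odot> b:] + \<beta> * \<psi> [:b \<lhd> a:], \<psi> [:a \<rhd> b + b \<lhd> a:]:]" if "?hom \<psi>" for \<psi> a b
  proof -
    interpret \<psi>: module_hom "free_act scale" "\<lambda>p z. poly p \<beta> * z" \<psi> by (fact that)
    have "\<psi> [:x, y:] = \<psi> [:x:] + \<beta> * \<psi> [:y:]" for x y
      using \<psi>.add[of "[:x:]" "[:0, y:]"] \<psi>.scale[of "[:0, 1:]" "[:y:]"]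
      by (simp add: act_generator)
    then show ?thesis
      by (simp add: quadratic_lprod_constants quadratic_base_def map_poly_pCons)
  qed
  show ?thesis
  proof
    assume ?equivalent
    then obtain \<psi> where hom: "?hom \<psi>" and \<alpha>': "\<And>x y. \<alpha>' x y = \<alpha> x y + map_poly \<psi> (?l x y)"
      using equivalent_extensions_iff[OF ext ext'] by blast
    interpret \<psi>: module_hom "free_act scale" "\<lambda>p z. poly p \<beta> * z" \<psi> by (fact hom)
    have "?lin (\<lambda>a. - \<psi> [:a:])"
    proof (unfold Vector_Spaces.linear_iff, intro conjI allI)
      show "vector_space scale" by (fact vector_space_axioms)
      show "vector_space ((*) :: complex \<Rightarrow> _)" by unfold_locales (simp_all add: algebra_simps)
      show "- \<psi> [:x + y:] = - \<psi> [:x:] + - \<psi> [:y:]" for x y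
        using \<psi>.add[of "[:x:]" "[:y:]"] by simp
      show "- \<psi> [:scale z x:] = z * - \<psi> [:x:]" for z x
        using \<psi>.scale[of "[:z:]" "[:x:]"] by (simp add: act_constant map_poly_pCons)
    qed
    moreover have "?coboundary (\<lambda>a. - \<psi> [:a:])"
      by (simp add: \<alpha>' on_constants[OF hom] monom_Suc monom_0)
    ultimately show "\<exists>\<phi>. ?lin \<phi> \<and> ?coboundary \<phi>"
      by blast
  next
    assume "\<exists>\<phi>. ?lin \<phi> \<and> ?coboundary \<phi>"
    then obtain \<phi> where "?lin \<phi>" and \<phi>: "?coboundary \<phi>" by blast
    have \<phi>_add: "\<phi> (x + y) = \<phi> x + \<phi> y" and \<phi>_scale: "\<phi> (scale z x) = z * \<phi> x" for x y z
      using \<open>?lin \<phi>\<close> by (simp_all add: Vector_Spaces.linear_iff)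
    have [simp]: "\<phi> 0 = 0"
      using \<phi>_add[of 0 0] by simp
    define \<psi> where "\<psi> x = - poly (map_poly \<phi> x) \<beta>" for x
    have [simp]: "\<psi> 0 = 0" by (simp add: \<psi>_def)
    have \<psi>_pCons: "\<psi> (pCons a x) = - \<phi> a + \<beta> * \<psi> x" for a x
      by (simp add: \<psi>_def map_poly_pCons)
    have \<psi>_add: "\<psi> (x + y) = \<psi> x + \<psi> y" for x y
    proof -
      have "map_poly \<phi> (x + y) = map_poly \<phi> x + map_poly \<phi> y"
        by (rule poly_eqI) (simp add: coeff_map_poly \<phi>_add)
      then show ?thesis by (simp add: \<psi>_def)
    qed
    have \<psi>_scale: "\<psi> (map_poly (scale z) x) = z * \<psi> x" for z x
    proof -
      have "map_poly \<phi> (map_poly (scale z) x) = smult z (map_poly \<phi> x)"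
        by (rule poly_eqI) (simp add: coeff_map_poly \<phi>_scale)
      then show ?thesis by (simp add: \<psi>_def)
    qed
    have hom: "?hom \<psi>"
    proof (unfold module_hom_iff, intro conjI allI)
      show "module (free_act scale)" by (fact base_module)
      show "module (\<lambda>p z. poly p \<beta> * z)" by unfold_locales (simp_all add: algebra_simps)
      show "\<psi> (x + y) = \<psi> x + \<psi> y" for x y by (fact \<psi>_add)
      show "\<psi> (free_act scale p x) = poly p \<beta> * \<psi> x" for p x
      proof (induction p)
        case (pCons z p)
        have "pCons z p = [:z:] + [:0, 1:] * p" by simp
        then have "free_act scale (pCons z p) x
            = free_act scale [:z:] x + free_act scale [:0, 1:] (free_act scale p x)"
          by (simp only: R.scale_left_distrib R.scale_scale)
        also have "\<psi> \<dots> = z * \<psi> x + \<beta> * \<psi> (free_act scale p x)"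
          by (simp add: act_constant act_generator \<psi>_add \<psi>_scale \<psi>_pCons del: R.scale_scale)
        finally show ?case
          by (simp add: pCons.IH distrib_right)
      qed simp
    qed
    \<comment> \<open>Applying \<open>\<psi>\<close> to the coefficients commutes with \<open>\<lambda>\<close> and turns \<open>\<partial>\<close> into \<open>\<beta>\<close>.\<close>
    have M_add: "map_poly \<psi> (F + G) = map_poly \<psi> F + map_poly \<psi> G"
      and M_diff: "map_poly \<psi> (F - G) = map_poly \<psi> F - map_poly \<psi> G"
      and M_del: "map_poly \<psi> (map_poly (pCons 0) F) = smult \<beta> (map_poly \<psi> F)" for F G
    proof -
      interpret \<psi>: module_hom "free_act scale" "\<lambda>p z. poly p \<beta> * z" \<psi> by (fact hom)
      show "map_poly \<psi> (F + G) = map_poly \<psi> F + map_poly \<psi> G"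
        "map_poly \<psi> (F - G) = map_poly \<psi> F - map_poly \<psi> G"
        "map_poly \<psi> (map_poly (pCons 0) F) = smult \<beta> (map_poly \<psi> F)"
        by (rule poly_eqI, simp add: coeff_map_poly \<psi>.add \<psi>.diff \<psi>_pCons)+
    qed
    have M_pCons: "map_poly \<psi> (pCons 0 F) = pCons 0 (map_poly \<psi> F)" for F
      by (simp add: map_poly_pCons)
    have constants: "\<alpha>' [:a:] [:b:] = \<alpha> [:a:] [:b:] + map_poly \<psi> (?l [:a:] [:b:])" for a b
      using \<phi> by (simp add: on_constants[OF hom] monom_Suc monom_0 \<psi>_pCons)
    have "\<alpha>' [:a:] y = \<alpha> [:a:] y + map_poly \<psi> (?l [:a:] y)" for a y
    proof (induction y)
      case (pCons b y)
      show ?case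
        unfolding cocycle_pCons(2)[of _ b y] e'.cocycle_pCons(2)[of _ b y] lprod_pCons(2)[of _ b y]
        by (simp add: pCons.IH constants M_add M_pCons M_del smult_add_right)
    qed simp
    then have "\<alpha>' x y = \<alpha> x y + map_poly \<psi> (?l x y)" for x y
    proof (induction x)
      case (pCons a x)
      show ?case
        unfolding cocycle_pCons(1)[of a x] e'.cocycle_pCons(1)[of a x] lprod_pCons(1)[of a x]
        by (simp add: pCons.IH pCons.prems M_diff M_pCons)
    qed simp
    then show ?equivalent
      using equivalent_extensions_iff[OF ext ext'] hom by blast
  qed
qed

end

section \<open>Coefficients and equivalence of cocycles\<close>

theorem theorem3p2:
  fixes scale :: "complex \<Rightarrow> 'v::ab_group_add \<Rightarrow> 'v"
    and lhd :: "'v \<Rightarrow> 'v \<Rightarrow> 'v" (infixl "\<lhd>" 70)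
    and rhd :: "'v \<Rightarrow> 'v \<Rightarrow> 'v" (infixl "\<rhd>" 70)
    and circ :: "'v \<Rightarrow> 'v \<Rightarrow> 'v" (infixl "\<odot>" 70)
    and ast :: "'v \<Rightarrow> 'v \<Rightarrow> 'v" (infixl "\<ast>" 70)
    and star :: "'v \<Rightarrow> 'v \<Rightarrow> 'v" (infixl "\<star>" 70)
    and \<beta> :: complex
    and \<alpha> :: "'v poly \<Rightarrow> 'v poly \<Rightarrow> complex poly"
    and \<alpha>c :: "nat \<Rightarrow> 'v \<Rightarrow> 'v \<Rightarrow> complex"
    and n :: nat
  assumes "pre_gelfand_dorfman_algebra scale (\<lhd>) (\<rhd>) (\<odot>)"
    and "\<And>a b. a \<ast> b = a \<rhd> b + a \<lhd> b"
    and "\<And>a b. a \<star> b = a \<rhd> b + b \<lhd> a"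
    and "central_extension (free_act scale) (quadratic_lprod (\<lhd>) (\<rhd>) (\<odot>)) \<beta> \<alpha>"
    and "\<And>i a b. \<alpha>c i a b = coeff (\<alpha> [:a:] [:b:]) i"
    and "\<And>a b. \<alpha> [:a:] [:b:] = (\<Sum>i\<le>n. monom (\<alpha>c i a b) i)"
    and "\<exists>a b. \<alpha>c n a b \<noteq> 0"
  shows "((\<forall>a b. \<alpha> [:a:] [:b:] = (\<Sum>i\<le>3. monom (\<alpha>c i a b) i)) \<longrightarrow>
      (\<forall>a b c.
        \<alpha>c 3 (a \<ast> b) c = \<alpha>c 3 (b \<ast> a) c \<and>
        \<alpha>c 3 (b \<ast> a) c = \<alpha>c 3 a (c \<lhd> b) \<and>
        \<alpha>c 3 a (c \<lhd> b) = \<alpha>c 3 b (a \<rhd> c) \<and>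
        \<alpha>c 2 (a \<ast> b) c - \<alpha>c 2 a (c \<lhd> b) - \<beta> * \<alpha>c 3 a (c \<lhd> b) - \<alpha>c 3 a (b \<odot> c)
          = \<alpha>c 3 (b \<odot> a) c - \<alpha>c 3 (a \<odot> b) c \<and>
        2 * \<alpha>c 2 (a \<ast> b) c - \<alpha>c 2 (b \<ast> a) c - \<alpha>c 2 a (b \<star> c)
          = 3 * \<alpha>c 3 (b \<odot> a) c - 3 * \<alpha>c 3 (a \<odot> b) c \<and>
        \<alpha>c 1 (a \<ast> b) c - \<alpha>c 1 a (c \<lhd> b) - \<beta> * \<alpha>c 2 a (c \<lhd> b) - \<alpha>c 2 a (b \<odot> c)
          = \<alpha>c 2 (b \<odot> a) c - \<alpha>c 2 (a \<odot> b) c \<and>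
        \<alpha>c 1 (a \<ast> b) c - \<alpha>c 1 (b \<ast> a) c - \<alpha>c 1 a (b \<star> c) + \<alpha>c 1 b (a \<star> c)
          = 2 * \<alpha>c 2 (b \<odot> a) c - 2 * \<alpha>c 2 (a \<odot> b) c \<and>
        \<alpha>c 0 (a \<ast> b) c - \<alpha>c 0 a (c \<lhd> b) + \<alpha>c 0 b (a \<star> c)
            - \<beta> * \<alpha>c 1 a (c \<lhd> b) - \<alpha>c 1 a (b \<odot> c)
          = \<alpha>c 1 (b \<odot> a) c - \<alpha>c 1 (a \<odot> b) c \<and>
        \<alpha>c 0 (a \<odot> b) c - \<beta> * \<alpha>c 0 a (c \<lhd> b) - \<alpha>c 0 a (b \<odot> c)
          = \<alpha>c 0 (b \<odot> a) c - \<beta> * \<alpha>c 0 b (c \<lhd> a) - \<alpha>c 0 b (a \<odot> c)))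
    \<and>
    (n > 3 \<longrightarrow>
      (\<forall>a b c. \<alpha>c n (a \<ast> b) c = 0 \<and> \<alpha>c n a (b \<star> c) = 0 \<and>
               \<alpha>c n a (b \<lhd> c) = 0 \<and> \<alpha>c n a (b \<rhd> c) = 0))
    \<and>
    (\<forall>\<alpha>'. central_extension (free_act scale) (quadratic_lprod (\<lhd>) (\<rhd>) (\<odot>)) \<beta> \<alpha>' \<longrightarrow>
      (equivalent_extensions (free_act scale) (quadratic_lprod (\<lhd>) (\<rhd>) (\<odot>)) \<beta> \<alpha> \<alpha>' \<longleftrightarrow>
       (\<exists>\<phi>. Vector_Spaces.linear scale (*) \<phi> \<and>
         (\<forall>a b. \<alpha> [:a:] [:b:] = \<alpha>' [:a:] [:b:] + [:\<beta> * \<phi> (b \<lhd> a):]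
                   + monom (\<phi> (a \<star> b)) 1 + [:\<phi> (a \<odot> b):]))))"
proof -
  interpret e: quadratic_central_extension scale "(\<lhd>)" "(\<rhd>)" "(\<odot>)" \<beta> \<alpha>
    using assms(1,4)
    by (simp add: quadratic_central_extension_def conformal_central_extension_def
        pre_gelfand_dorfman_algebra_def pre_novikov_algebra_def)
  have \<alpha>c: "\<alpha>c i a b = e.cf i a b" for i a b
    by (simp add: e.cf_def assms(5))
  have bound: "e.cf k a b = 0"
    if "\<alpha> [:a:] [:b:] = (\<Sum>i\<le>m. monom (\<alpha>c i a b) i)" and "m < k" for a b k m
    using that(2) by (simp add: e.cf_def that(1) coeff_sum)
  show ?thesis
  proof (rule conjI[OF impI conjI[OF impI allI[OF impI]]], goal_cases)
    case 1
    then have cubic: "e.cf k a b = 0" if "3 < k" for k a b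
      using bound that by blast
    show ?case
      unfolding \<alpha>c assms(2,3) by (intro allI conjI e.cocycle_equations_cubic cubic)
  next
    case 2
    have "e.cf (Suc n) a b = 0" for a b
      using bound[OF assms(6)] by simp
    note trivial = e.top_coefficient_trivial[OF 2 this]
    show ?case
      unfolding \<alpha>c assms(2,3) by (intro allI conjI trivial)
  next
    case (3 \<alpha>')
    from e.equivalent_iff_linear_functional[OF this] show ?case
      unfolding assms(3) .
  qed
qed

end
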